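(* Let $\widetilde x=\{x_\alpha\}_{\alpha\in(0,1]}$ be a fuzzy vector, let $g:(0,1]\to(0,1]$ be a strictly increasing bijection, and let $\widetilde y=\{y_t\}_{t\in(0,1]}$ be the reparameterized fuzzy vector $y_t=x_{g(t)}$. For $\alpha\in(0,1]$ put $\widetilde X_\alpha=\operatorname{span}\{x_\beta:\beta\in[\alpha,1]\}$ and $\widetilde Y_\alpha=\operatorname{span}\{y_t:t\in[\alpha,1]\}$, and let $$\delta_X(\alpha)=\dim(\widetilde X_\alpha),\qquad \delta_Y(\alpha)=\dim(\widetilde Y_\alpha).$$ Then $\delta_Y(\alpha)=\delta_X(g(\alpha))$ for all $\alpha\in(0,1]$. Consequently: 1. The family of attained dimensions is preserved. 2. The jump points of the dimension function are mapped by $\alpha\longmapsto g^{-1}(\alpha)$. 3. The ordered sequence of dimensions $\dim(\widetilde X_1),\dim(\widetilde X_\alpha),\ldots$ is preserved up to the monotone change of parameter. Hence the dimension profile of a fuzzy labeling is an order-theoretic invariant.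
   Context: Let $V$ be a vector space over $\mathbb R$ or $\mathbb C$ and $X$ a vector subspace of $V$. A fuzzy labeling on $X$ is a map $(0,1]\times X\to V$, $(\alpha,x)\mapsto x_\alpha$, with $x_1=x$ for all $x\in X$. For $x\in X$, the family $\widetilde x=\{x_\alpha\}_{\alpha\in(0,1]}$ is called the fuzzy vector associated with $x$. The function $\alpha\mapsto\dim(\widetilde X_\alpha)$ is called the dimension profile (dimension function). The terms "jump points" (levels at which the dimension changes), "preserved up to the monotone change of parameter" and "order-theoretic invariant" (depending only on the ordering of the levels, not on their numerical parametrization) are used informally. *)

theory Defs
  imports "HOL-Analysis.Analysis" "HOL-Library.Equipollence"
begin

text \<open>
  The ambient space \<open>V\<close> is the whole type \<open>'v\<close>, with scalar multiplication
  \<open>scl :: 'k \<Rightarrow> 'v \<Rightarrow> 'v\<close> over \<open>'k::real_normed_field\<close>.  By the Gelfand-Mazur theorem, the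
  instances of this class are, up to isomorphism, exactly the real and the complex field.
\<close>

subsection \<open>Dimension\<close>

text \<open>
  The span of a fuzzy vector may be infinite-dimensional, where \<^const>\<open>vector_space.dim\<close>
  returns the dummy value 0.  So the dimension is taken to be the cardinality of a basis, as an
  element of the type of cardinal numbers of subsets of \<open>'v\<close>.
\<close>

quotient_type 'v cardinal = "'v set" / "eqpoll :: 'v set \<Rightarrow> 'v set \<Rightarrow> bool"
  by (rule equivpI) (auto intro: reflpI sympI transpI eqpoll_sym eqpoll_trans)

definition vdim :: "('k::field \<Rightarrow> 'v::ab_group_add \<Rightarrow> 'v) \<Rightarrow> 'v set \<Rightarrow> 'v cardinal"
  where "vdim scl S =
    abs_cardinal (SOME B. \<not> module.dependent scl B \<and> module.span scl B = module.span scl S)"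

lemma vdim_eq:
  assumes "vector_space scl" "\<not> module.dependent scl B"
    and "module.span scl B = module.span scl S"
  shows "vdim scl S = abs_cardinal B"
proof -
  interpret vector_space scl by fact
  let ?P = "\<lambda>B. independent B \<and> span B = span S"
  have "?P (SOME B. ?P B)" using assms by (intro someI[of ?P B]) auto
  then obtain f where "bij_betw f B (SOME B. ?P B)"
    using bij_if_span_eq_span_bases[of B "SOME B. ?P B"] assms by auto
  then have "B \<approx> (SOME B. ?P B)" unfolding eqpoll_def by blast
  then show ?thesis
    unfolding vdim_def by (simp add: cardinal.abs_eq_iff eqpoll_sym)
qed

lemma vdim_eq_iff_dim_eq:
  assumes "vector_space scl" "finite S" "finite T"
  shows "vdim scl S = vdim scl T \<longleftrightarrow> vector_space.dim scl S = vector_space.dim scl T"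
proof -
  interpret vector_space scl by fact
  obtain B C where B: "B \<subseteq> S" "independent B" "S \<subseteq> span B" "card B = dim S"
    and C: "C \<subseteq> T" "independent C" "T \<subseteq> span C" "card C = dim T"
    using basis_exists by metis
  have "span B = span S" "span C = span T"
    using B C by (auto simp: span_eq intro: span_base)
  then have "vdim scl S = abs_cardinal B" "vdim scl T = abs_cardinal C"
    using B C vdim_eq[OF assms(1)] by auto
  moreover have "finite B" "finite C" using assms(2,3) B(1) C(1) by (auto intro: finite_subset)
  ultimately show ?thesis using B C by (simp add: cardinal.abs_eq_iff eqpoll_iff_card)
qed

subsection \<open>Fuzzy labelings and dimension profiles\<close>

abbreviation levels :: "real set"
  where "levels \<equiv> {0<..1}"

text \<open>
  Labelings, fuzzy vectors and profiles are total functions of the level; only their values on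
  \<^term>\<open>levels\<close> matter.
\<close>

definition fuzzy_labeling :: "'v set \<Rightarrow> (real \<Rightarrow> 'v \<Rightarrow> 'v) \<Rightarrow> bool"
  where "fuzzy_labeling X L \<longleftrightarrow> (\<forall>x\<in>X. L 1 x = x)"

definition fuzzy_vector :: "(real \<Rightarrow> 'v \<Rightarrow> 'v) \<Rightarrow> 'v \<Rightarrow> real \<Rightarrow> 'v"
  where "fuzzy_vector L x = (\<lambda>\<alpha>. L \<alpha> x)"

definition level_span ::
    "('k::field \<Rightarrow> 'v::ab_group_add \<Rightarrow> 'v) \<Rightarrow> (real \<Rightarrow> 'v) \<Rightarrow> real \<Rightarrow> 'v set"
  where "level_span scl f \<alpha> = module.span scl (f ` {\<alpha>..1})"

definition dimension_profile ::
    "('k::field \<Rightarrow> 'v::ab_group_add \<Rightarrow> 'v) \<Rightarrow> (real \<Rightarrow> 'v) \<Rightarrow> real \<Rightarrow> 'v cardinal"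
  where "dimension_profile scl f \<alpha> = vdim scl (level_span scl f \<alpha>)"

text \<open>
  A profile changes at \<open>\<alpha>\<close> if it is not constant on any neighbourhood of \<open>\<alpha>\<close> in the set of
  levels.  This covers a change between \<open>\<alpha>\<close> and the levels just below as well as a change between
  \<open>\<alpha>\<close> and the levels just above.
\<close>

definition jump_points :: "(real \<Rightarrow> 'd) \<Rightarrow> real set"
  where "jump_points \<delta> =
    {\<alpha> \<in> levels. \<not> (\<forall>\<^sub>F \<beta> in at \<alpha> within levels. \<delta> \<beta> = \<delta> \<alpha>)}"

definition level_change :: "(real \<Rightarrow> real) \<Rightarrow> bool"
  where "level_change \<phi> \<longleftrightarrow> strict_mono_on levels \<phi> \<and> bij_betw \<phi> levels levels"

text \<open>The levels listed in the order in which the spans grow, beginning with level 1.\<close>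

definition level_sequence :: "real list \<Rightarrow> bool"
  where "level_sequence as \<longleftrightarrow>
    as \<noteq> [] \<and> hd as = 1 \<and> set as \<subseteq> levels \<and> sorted_wrt (>) as"

text \<open>
  A level-dependent quantity \<open>\<Phi> L x \<alpha>\<close>, attached to labelings \<open>L\<close> of \<open>X\<close> and vectors \<open>x \<in> X\<close>,
  depends only on the ordering of the levels: if two labelings correspond under an order
  isomorphism of the levels, then so do the associated quantities.
\<close>

definition order_theoretic_invariant ::
    "'v set \<Rightarrow> ((real \<Rightarrow> 'v \<Rightarrow> 'v) \<Rightarrow> 'v \<Rightarrow> real \<Rightarrow> 'd) \<Rightarrow> bool"
  where "order_theoretic_invariant X \<Phi> \<longleftrightarrow>
    (\<forall>L M \<phi>. fuzzy_labeling X L \<longrightarrow> fuzzy_labeling X M \<longrightarrow> level_change \<phi> \<longrightarrow>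
      (\<forall>t\<in>levels. \<forall>x\<in>X. M t x = L (\<phi> t) x) \<longrightarrow>
      (\<forall>t\<in>levels. \<forall>x\<in>X. \<Phi> M x t = \<Phi> L x (\<phi> t)))"

end

theory Submission
  imports Defs
begin

text \<open>
  A level change maps \<open>[\<alpha>,1]\<close> onto \<open>[\<phi>(\<alpha>),1]\<close>, so the spans and hence the dimensions at
  corresponding levels agree.  As an order isomorphism it is also a homeomorphism of the levels,
  so it carries jump points to jump points.
\<close>

lemma level_change_in_levels: "level_change \<phi> \<Longrightarrow> \<alpha> \<in> levels \<Longrightarrow> \<phi> \<alpha> \<in> levels"
  unfolding level_change_def by (blast dest: bij_betwE)

lemma level_change_less_iff:
  assumes "level_change \<phi>" "\<alpha> \<in> levels" "\<beta> \<in> levels"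
  shows "\<phi> \<alpha> < \<phi> \<beta> \<longleftrightarrow> \<alpha> < \<beta>"
  using assms strict_mono_on_less unfolding level_change_def by blast

lemma level_change_surj:
  assumes "level_change \<phi>" "\<beta> \<in> levels"
  obtains \<alpha> where "\<alpha> \<in> levels" "\<phi> \<alpha> = \<beta>"
  using assms unfolding level_change_def bij_betw_def by (metis imageE)

text \<open>Monotonicity together with \<phi> t \<le> 1 puts the image inside the interval.
  Conversely, a level above \<open>\<phi> \<alpha>\<close> has a preimage by surjectivity, and
  reflecting the order places that preimage above \<alpha>.\<close>

lemma level_change_atLeastAtMost:
  assumes \<phi>: "level_change \<phi>" and \<alpha>: "\<alpha> \<in> levels"
  shows "\<phi> ` {\<alpha>..1} = {\<phi> \<alpha>..1}"
proof (intro equalityI subsetI)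
  fix \<beta> assume "\<beta> \<in> \<phi> ` {\<alpha>..1}"
  then obtain t where t: "t \<in> levels" "\<alpha> \<le> t" "\<beta> = \<phi> t" using \<alpha> by auto
  then show "\<beta> \<in> {\<phi> \<alpha>..1}"
    using level_change_less_iff[OF \<phi> t(1) \<alpha>] level_change_in_levels[OF \<phi> t(1)] by auto
next
  fix \<beta> assume \<beta>: "\<beta> \<in> {\<phi> \<alpha>..1}"
  then have "\<beta> \<in> levels" using level_change_in_levels[OF \<phi> \<alpha>] by auto
  then obtain t where t: "t \<in> levels" "\<phi> t = \<beta>" using level_change_surj[OF \<phi>] by metis
  then show "\<beta> \<in> \<phi> ` {\<alpha>..1}"
    using \<beta> level_change_less_iff[OF \<phi> t(1) \<alpha>] by (intro image_eqI[of _ _ t]) auto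
qed

text \<open>The generators of the two spans form literally the same set, so the spans coincide as
  sets and no basis has to be compared.\<close>

lemma dimension_profile_level_change:
  assumes \<phi>: "level_change \<phi>" and h: "\<forall>t\<in>levels. h t = f (\<phi> t)" and \<alpha>: "\<alpha> \<in> levels"
  shows "dimension_profile scl h \<alpha> = dimension_profile scl f (\<phi> \<alpha>)"
proof -
  have "h ` {\<alpha>..1} = f ` \<phi> ` {\<alpha>..1}"
    using h \<alpha> unfolding image_image by (intro image_cong) auto
  then show ?thesis
    unfolding dimension_profile_def level_span_def level_change_atLeastAtMost[OF \<phi> \<alpha>] by simp
qed

text \<open>Closure under inverses lets each one-sided transfer result be applied a second time to
  the inverse, which yields the reverse inclusion.\<close>

lemma level_change_the_inv_into:
  assumes "level_change \<phi>"
  shows "level_change (the_inv_into levels \<phi>)"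
proof -
  have bij: "bij_betw \<phi> levels levels" using assms unfolding level_change_def by blast
  have bij': "bij_betw (the_inv_into levels \<phi>) levels levels"
    using bij by (rule bij_betw_the_inv_into)
  have "strict_mono_on levels (the_inv_into levels \<phi>)"
  proof (rule strict_mono_onI)
    fix r s :: real
    assume rs: "r \<in> levels" "s \<in> levels" "r < s"
    have "\<phi> (the_inv_into levels \<phi> r) = r" "\<phi> (the_inv_into levels \<phi> s) = s"
      using f_the_inv_into_f_bij_betw[OF bij] rs by auto
    then show "the_inv_into levels \<phi> r < the_inv_into levels \<phi> s"
      using rs bij_betwE[OF bij'] level_change_less_iff[OF assms] by metis
  qed
  with bij' show ?thesis unfolding level_change_def by blast
qed

text \<open>An order bound on values of \<phi> pulls back to an order bound on arguments, because
  the bound is itself a value of \<phi> whenever it is a level. The filter is punctured on both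
  sides, matching the neighbourhoods in \<open>jump_points\<close>.\<close>

lemma filterlim_level_change:
  assumes \<phi>: "level_change \<phi>" and \<alpha>: "\<alpha> \<in> levels"
  shows "filterlim \<phi> (at (\<phi> \<alpha>) within levels) (at \<alpha> within levels)"
proof -
  let ?F = "at \<alpha> within levels"
  have lev: "\<forall>\<^sub>F \<beta> in ?F. \<beta> \<in> levels" and ne: "\<forall>\<^sub>F \<beta> in ?F. \<beta> \<noteq> \<alpha>"
    by (simp_all add: eventually_at_filter)
  have id: "((\<lambda>\<beta>. \<beta>) \<longlongrightarrow> \<alpha>) ?F" by (rule tendsto_ident_at)
  have "(\<phi> \<longlongrightarrow> \<phi> \<alpha>) ?F"
  proof (rule order_tendstoI)
    fix l assume l: "l < \<phi> \<alpha>"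
    \<comment> \<open>A bound \<open>l\<close> outside the levels has no preimage, but being \<le> 0
      it lies below every value of \<phi>. Otherwise its preimage \<open>c\<close> satisfies c <
      \<alpha>, and levels near \<alpha> exceed \<open>c\<close>.\<close>
    show "\<forall>\<^sub>F \<beta> in ?F. l < \<phi> \<beta>"
    proof (cases "l \<le> 0")
      case True
      show ?thesis using lev
      proof eventually_elim
        case (elim \<beta>)
        then show ?case using True level_change_in_levels[OF \<phi> elim] by auto
      qed
    next
      case False
      then have "l \<in> levels" using l level_change_in_levels[OF \<phi> \<alpha>] by auto
      then obtain c where c: "c \<in> levels" "\<phi> c = l" using level_change_surj[OF \<phi>] by metis
      have "\<forall>\<^sub>F \<beta> in ?F. c < \<beta>"
        using order_tendstoD(1)[OF id] l c \<alpha> level_change_less_iff[OF \<phi>] by blast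
      with lev show ?thesis
        by eventually_elim (use c level_change_less_iff[OF \<phi>] in blast)
    qed
  next
    fix u assume u: "\<phi> \<alpha> < u"
    \<comment> \<open>Dual argument; the case u = 1 belongs to the second branch, since 1 is a level
      and hence has a preimage.\<close>
    show "\<forall>\<^sub>F \<beta> in ?F. \<phi> \<beta> < u"
    proof (cases "u > 1")
      case True
      show ?thesis using lev
      proof eventually_elim
        case (elim \<beta>)
        then show ?case using True level_change_in_levels[OF \<phi> elim] by auto
      qed
    next
      case False
      then have "u \<in> levels" using u level_change_in_levels[OF \<phi> \<alpha>] by auto
      then obtain c where c: "c \<in> levels" "\<phi> c = u" using level_change_surj[OF \<phi>] by metis
      have "\<forall>\<^sub>F \<beta> in ?F. \<beta> < c"
        using order_tendstoD(2)[OF id] u c \<alpha> level_change_less_iff[OF \<phi>] by blast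
      with lev show ?thesis
        by eventually_elim (use c level_change_less_iff[OF \<phi>] in blast)
    qed
  qed
  \<comment> \<open>Injectivity keeps the values off the limit point, as the punctured target filter
    demands.\<close>
  moreover have "\<forall>\<^sub>F \<beta> in ?F. \<phi> \<beta> \<in> levels \<and> \<phi> \<beta> \<noteq> \<phi> \<alpha>"
    using lev ne
  proof eventually_elim
    case (elim \<beta>)
    then show ?case
      using level_change_in_levels[OF \<phi>] level_change_less_iff[OF \<phi>] \<alpha>
      by (metis less_irrefl linorder_neqE)
  qed
  ultimately show ?thesis by (simp add: filterlim_at)
qed

text \<open>By contraposition: if \<delta> is constant near \<open>\<phi> \<alpha>\<close>,
  composing with \<phi> makes \<open>\<delta>'\<close> constant near \<alpha>.\<close>

lemma jump_points_level_change:
  assumes \<phi>: "level_change \<phi>" and \<delta>: "\<forall>t\<in>levels. \<delta>' t = \<delta> (\<phi> t)"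
    and \<alpha>: "\<alpha> \<in> jump_points \<delta>'"
  shows "\<phi> \<alpha> \<in> jump_points \<delta>"
proof (rule ccontr)
  have lev: "\<alpha> \<in> levels" using \<alpha> unfolding jump_points_def by blast
  assume "\<phi> \<alpha> \<notin> jump_points \<delta>"
  then have "\<forall>\<^sub>F \<beta> in at (\<phi> \<alpha>) within levels. \<delta> \<beta> = \<delta> (\<phi> \<alpha>)"
    using level_change_in_levels[OF \<phi> lev] unfolding jump_points_def by blast
  then have "\<forall>\<^sub>F \<beta> in at \<alpha> within levels. \<delta> (\<phi> \<beta>) = \<delta> (\<phi> \<alpha>)"
    using filterlim_level_change[OF \<phi> lev] by (rule eventually_compose_filterlim)
  \<comment> \<open>The identity between \<open>\<delta>'\<close> and \<delta> is available on
    levels only.\<close>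
  moreover have "\<forall>\<^sub>F \<beta> in at \<alpha> within levels. \<beta> \<in> levels"
    by (simp add: eventually_at_filter)
  ultimately have "\<forall>\<^sub>F \<beta> in at \<alpha> within levels. \<delta>' \<beta> = \<delta>' \<alpha>"
    by eventually_elim (use \<delta> lev in simp)
  with \<alpha> show False unfolding jump_points_def by blast
qed

text \<open>An order isomorphism fixes the greatest level: the preimage \<open>t\<close> of 1 does
  not exceed 1, so \<phi> 1 cannot be smaller than \<phi> t = 1.\<close>

lemma level_change_1: "level_change \<phi> \<Longrightarrow> \<phi> 1 = 1"
proof -
  assume \<phi>: "level_change \<phi>"
  have "\<phi> ` {1..1} = {\<phi> 1..1}" by (rule level_change_atLeastAtMost[OF \<phi>]) simp
  moreover obtain t where "t \<in> levels" "\<phi> t = 1" using level_change_surj[OF \<phi>, of 1] by auto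
  ultimately show ?thesis
    using level_change_less_iff[OF \<phi>, of 1 t] level_change_in_levels[OF \<phi>, of 1] by fastforce
qed

lemma level_sequence_map:
  assumes \<phi>: "level_change \<phi>" and as: "level_sequence as"
  shows "level_sequence (map \<phi> as)"
proof -
  have lev: "set as \<subseteq> levels" and sorted: "sorted_wrt (>) as"
    using as unfolding level_sequence_def by auto
  have "sorted_wrt (\<lambda>x y. \<phi> x > \<phi> y) as"
    using lev level_change_less_iff[OF \<phi>]
    by (intro sorted_wrt_mono_rel[OF _ sorted]) blast
  then show ?thesis
    using as lev level_change_1[OF \<phi>] level_change_in_levels[OF \<phi>]
    unfolding level_sequence_def by (auto simp: hd_map sorted_wrt_map)
qed

text \<open>Lists of levels descending from 1 make the ordered sequence of dimensions precise, with
  \<open>g_inv\<close> as the monotone change of parameter. The last two conjuncts express the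
  closing claim: reparameterization stays within fuzzy labelings, and the profile is transported
  along it.\<close>

theorem corollary4p1:
  fixes scl :: "'k::real_normed_field \<Rightarrow> 'v::ab_group_add \<Rightarrow> 'v"
    and X :: "'v set" and L :: "real \<Rightarrow> 'v \<Rightarrow> 'v" and x :: 'v
    and g g_inv :: "real \<Rightarrow> real" and xf yf :: "real \<Rightarrow> 'v"
    and \<delta>X \<delta>Y :: "real \<Rightarrow> 'v cardinal"
  assumes V: "vector_space scl"
    and X: "module.subspace scl X"
    and L: "fuzzy_labeling X L"
    and x: "x \<in> X"
    and xf: "xf = fuzzy_vector L x"
    and g_mono: "strict_mono_on {0<..1} g"
    and g_bij: "bij_betw g {0<..1} {0<..1}"
    and yf: "\<forall>t\<in>{0<..1}. yf t = xf (g t)"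
    and \<delta>X: "\<delta>X = dimension_profile scl xf"
    and \<delta>Y: "\<delta>Y = dimension_profile scl yf"
    and g_inv: "g_inv = the_inv_into {0<..1} g"
  shows "(\<forall>\<alpha>\<in>{0<..1}. \<delta>Y \<alpha> = \<delta>X (g \<alpha>))
    \<and> \<delta>Y ` {0<..1} = \<delta>X ` {0<..1}
    \<and> jump_points \<delta>Y = g_inv ` jump_points \<delta>X
    \<and> (level_change g_inv
        \<and> (\<forall>\<alpha>\<in>{0<..1}. \<delta>Y (g_inv \<alpha>) = \<delta>X \<alpha>)
        \<and> (\<forall>as. level_sequence as \<longrightarrow>
              level_sequence (map g_inv as) \<and> map \<delta>Y (map g_inv as) = map \<delta>X as)
        \<and> {map \<delta>Y as | as. level_sequence as} = {map \<delta>X as | as. level_sequence as})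
    \<and> (\<forall>\<phi>. level_change \<phi> \<longrightarrow> fuzzy_labeling X (\<lambda>t. L (\<phi> t)))
    \<and> order_theoretic_invariant X (\<lambda>M z. dimension_profile scl (fuzzy_vector M z))"
proof -
  have g: "level_change g" using g_mono g_bij unfolding level_change_def by blast
  have gi: "level_change g_inv" unfolding g_inv using g by (rule level_change_the_inv_into)
  have g_gi: "g (g_inv \<alpha>) = \<alpha>" if "\<alpha> \<in> levels" for \<alpha>
    unfolding g_inv using f_the_inv_into_f_bij_betw[OF g_bij] that by simp
  have gi_g: "g_inv (g \<alpha>) = \<alpha>" if "\<alpha> \<in> levels" for \<alpha>
    unfolding g_inv using the_inv_into_f_f[OF bij_betw_imp_inj_on[OF g_bij] that] .
  have YX: "\<forall>\<alpha>\<in>levels. \<delta>Y \<alpha> = \<delta>X (g \<alpha>)"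
    unfolding \<delta>X \<delta>Y using dimension_profile_level_change[OF g yf] by blast
  \<comment> \<open>This has the shape of \<open>YX\<close> with the two profiles exchanged and
    \<open>g_inv\<close> in place of \<open>g\<close>, so the transfer lemmas apply in both
    directions.\<close>
  have XY: "\<forall>\<alpha>\<in>levels. \<delta>X \<alpha> = \<delta>Y (g_inv \<alpha>)"
    using YX g_gi level_change_in_levels[OF gi] by simp
  have dims: "\<delta>Y ` levels = \<delta>X ` levels"
  proof -
    have "\<delta>Y ` levels = \<delta>X ` g ` levels" unfolding image_image using YX by (intro image_cong) auto
    then show ?thesis using g_bij by (simp add: bij_betw_def)
  qed
  have jumps: "jump_points \<delta>Y = g_inv ` jump_points \<delta>X"
  proof (intro equalityI subsetI)
    fix \<alpha> assume \<alpha>: "\<alpha> \<in> jump_points \<delta>Y"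
    then have "\<alpha> = g_inv (g \<alpha>)" using gi_g unfolding jump_points_def by auto
    then show "\<alpha> \<in> g_inv ` jump_points \<delta>X"
      using jump_points_level_change[OF g YX \<alpha>] by blast
  next
    fix \<alpha> assume "\<alpha> \<in> g_inv ` jump_points \<delta>X"
    then show "\<alpha> \<in> jump_points \<delta>Y" using jump_points_level_change[OF gi XY] by blast
  qed
  have map_gi: "map \<delta>Y (map g_inv as) = map \<delta>X as" if "level_sequence as" for as
    using that XY unfolding level_sequence_def by auto
  have map_g: "map \<delta>X (map g as) = map \<delta>Y as" if "level_sequence as" for as
    using that YX unfolding level_sequence_def by auto
  have seqs: "{map \<delta>Y as | as. level_sequence as} = {map \<delta>X as | as. level_sequence as}"
  proof (intro equalityI subsetI)
    fix ds assume "ds \<in> {map \<delta>Y as | as. level_sequence as}"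
    then obtain as where "level_sequence as" "ds = map \<delta>Y as" by blast
    then show "ds \<in> {map \<delta>X as | as. level_sequence as}"
      using map_g level_sequence_map[OF g] by (metis (mono_tags, lifting) mem_Collect_eq)
  next
    fix ds assume "ds \<in> {map \<delta>X as | as. level_sequence as}"
    then obtain as where "level_sequence as" "ds = map \<delta>X as" by blast
    then show "ds \<in> {map \<delta>Y as | as. level_sequence as}"
      using map_gi level_sequence_map[OF gi] by (metis (mono_tags, lifting) mem_Collect_eq)
  qed
  \<comment> \<open>The normalization at level 1 survives because \<phi> fixes 1.\<close>
  have labeling: "\<forall>\<phi>. level_change \<phi> \<longrightarrow> fuzzy_labeling X (\<lambda>t. L (\<phi> t))"
    using L by (simp add: fuzzy_labeling_def level_change_1)
  \<comment> \<open>The correspondence of the labelings, read at a fixed vector, is the hypothesis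
    of \<open>dimension_profile_level_change\<close> for their fuzzy vectors.\<close>
  have "order_theoretic_invariant X (\<lambda>M z. dimension_profile scl (fuzzy_vector M z))"
    unfolding order_theoretic_invariant_def
    by (intro allI impI ballI dimension_profile_level_change) (auto simp: fuzzy_vector_def)
  with YX XY dims jumps gi map_gi level_sequence_map[OF gi] seqs labeling show ?thesis
    by (intro conjI allI impI ballI) simp_all
qed

end
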